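(* Let $\mathcal{P}$ be a basic cell of a lattice $\mathbf{G}\mathbb{Z}^n$ ($\mathbf{G}\in\mathbb{R}^{n\times n}$ full-rank), let $\mathcal{A}\subseteq\mathcal{P}$ with $\mu(\mathcal{A})>0$, and let $(P_S,Q_{\mathcal{A},\mathcal{P}})$ be the rejection-sampled universal quantizer (RSUQ) for $\mathcal{A}$ against $\mathcal{P}$. For any $\mathbf{x}\in\mathbb{R}^n$, the quantization error $\mathbf{Z}:=Q_{\mathcal{A},\mathcal{P}}(\mathbf{x},S)-\mathbf{x}$ (where $S\sim P_S$) follows the uniform distribution over the set $\mathcal{A}$, i.e., $\mathbf{Z}\sim\mathrm{Unif}(\mathcal{A})$.
   Context: $\mu$ is Lebesgue measure on $\mathbb{R}^n$; all sets are measurable. A bounded set $\mathcal{P}\subseteq\mathbb{R}^n$ is a basic cell of $\mathbf{G}\mathbb{Z}^n=\{\mathbf{G}\mathbf{j}:\mathbf{j}\in\mathbb{Z}^n\}$ if the translates $(\mathcal{P}+\mathbf{G}\mathbf{j})_{\mathbf{j}\in\mathbb{Z}^n}$ partition $\mathbb{R}^n$. For a basic cell $\mathcal{P}$, $Q_{\mathcal{P}}(\mathbf{x})$ is the unique lattice point $\mathbf{y}\in\mathbf{G}\mathbb{Z}^n$ with $\mathbf{x}\in-\mathcal{P}+\mathbf{y}$. RSUQ for $\mathcal{A}$ against $\mathcal{P}$: the state is $S=(\mathbf{V}_i)_{i\ge1}$ with $\mathbf{V}_1,\mathbf{V}_2,\ldots$ i.i.d. $\mathrm{Unif}(\mathcal{P})$,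 and $Q_{\mathcal{A},\mathcal{P}}(\mathbf{x},(\mathbf{v}_i)_i)=Q_{\mathcal{P}}(\mathbf{x}-\mathbf{v}_k)+\mathbf{v}_k$, where $k=\min\{i:Q_{\mathcal{P}}(\mathbf{x}-\mathbf{v}_i)+\mathbf{v}_i-\mathbf{x}\in\mathcal{A}\}$ (which exists almost surely for each fixed $\mathbf{x}$). *)

theory Defs
  imports "HOL-Probability.Probability"
begin

definition lattice_point :: "real^'n^'n \<Rightarrow> int^'n \<Rightarrow> real^'n" where
  "lattice_point G j = G *v (\<chi> i. of_int (j $ i))"

definition lattice_points :: "real^'n^'n \<Rightarrow> (real^'n) set" where
  "lattice_points G = range (lattice_point G)"

definition basic_cell :: "real^'n^'n \<Rightarrow> (real^'n) set \<Rightarrow> bool" where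
  "basic_cell G P \<longleftrightarrow>
     bounded P \<and>
     disjoint_family (\<lambda>j. (\<lambda>p. p + lattice_point G j) ` P) \<and>
     (\<Union>j. (\<lambda>p. p + lattice_point G j) ` P) = UNIV"

definition cell_quantizer :: "real^'n^'n \<Rightarrow> (real^'n) set \<Rightarrow> real^'n \<Rightarrow> real^'n" where
  "cell_quantizer G P x = (THE y. y \<in> lattice_points G \<and> x \<in> (\<lambda>p. - p + y) ` P)"

text \<open>The law of an i.i.d. sequence of points, uniform on \<open>P\<close> and indexed from 1.\<close>

definition rsuq_state :: "(real^'n) set \<Rightarrow> (nat \<Rightarrow> real^'n) measure" where
  "rsuq_state P = (\<Pi>\<^sub>M i\<in>{1..}. uniform_measure lebesgue P)"

text \<open>On the states for which no index is accepted (a null event for each fixed \<open>x\<close>),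
  \<open>LEAST\<close> returns an unspecified index that does not depend on the state.\<close>

definition rsuq :: "real^'n^'n \<Rightarrow> (real^'n) set \<Rightarrow> (real^'n) set
    \<Rightarrow> real^'n \<Rightarrow> (nat \<Rightarrow> real^'n) \<Rightarrow> real^'n" where
  "rsuq G A P x v =
     (let k = (LEAST i. 1 \<le> i \<and> cell_quantizer G P (x - v i) + v i - x \<in> A)
      in cell_quantizer G P (x - v k) + v k)"

end

(* Modulo the lattice, P is a fundamental domain, so the error of a single dithered attempt
   folds v - x back into P. This folding preserves Lebesgue measure piecewise, hence it maps
   Unif(P) to Unif(P). The first accepted attempt then has the conditional law given A: the
   event "first acceptance at attempt n + 1, with error in B" has probability (1 - p)^n q
   with p = mu(A) / mu(P), q = mu(A \<inter> B) / mu(P), and the geometric series sums to q / p. *)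

theory Submission
  imports Defs
begin

section \<open>Rejection sampling\<close>

text \<open>If nothing is accepted, \<open>LEAST\<close> may return 0, and then \<open>v 0 = undefined\<close>; the condition
  \<open>space L = UNIV\<close> keeps \<open>T undefined\<close> in the codomain.\<close>

lemma
  fixes T :: "'a \<Rightarrow> 'b" and A :: "'b set"
  assumes N: "prob_space N" and T: "T \<in> measurable N L" and L: "space L = UNIV"
    and A: "A \<in> sets L"
  defines "f \<equiv> \<lambda>v. T (v (LEAST i::nat. 1 \<le> i \<and> T (v i) \<in> A))"
  shows measurable_rejection_sampling: "f \<in> measurable (\<Pi>\<^sub>M i\<in>{1..}. N) L"
    and distr_rejection_sampling: "emeasure (distr N L T) A > 0 \<Longrightarrow>
      distr (\<Pi>\<^sub>M i\<in>{1..}. N) L f = uniform_measure (distr N L T) A"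
proof -
  interpret N: prob_space N by fact
  interpret product_prob_space "\<lambda>_. N" "{1::nat..}"
    by unfold_locales
  let ?\<Pi> = "\<Pi>\<^sub>M i\<in>{1::nat..}. N"
  note T[measurable] A[measurable]
  have comp[measurable]: "(\<lambda>v. T (v i)) \<in> measurable ?\<Pi> L" for i
  proof (cases "1 \<le> i")
    case True
    then show ?thesis
      by (intro measurable_compose[OF _ T] measurable_component_singleton) auto
  next
    case False
    have "(\<lambda>v. T (v i)) \<in> measurable ?\<Pi> L \<longleftrightarrow> (\<lambda>v. T undefined) \<in> measurable ?\<Pi> L"
      using False by (intro measurable_cong) (auto simp: space_PiM PiE_def extensional_def)
    then show ?thesis by (simp add: L)
  qed
  \<comment> \<open>The chosen index takes countably many values, so \<open>f\<close> is glued from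
    the maps in \<open>comp\<close>, one for each value.\<close>
  show f[measurable]: "f \<in> measurable ?\<Pi> L"
    unfolding f_def by (rule measurable_compose_countable) measurable

  define p where "p = N.prob (T -` A \<inter> space N)"
  define q where "q B = N.prob (T -` (A \<inter> B) \<inter> space N)" for B
  \<comment> \<open>\<open>X\<close> holds the coordinate constraints for the event
    \<open>C B n\<close>: attempts 1 to n miss \<open>A\<close>, and attempt \<open>Suc n\<close>
    lands in \<open>A \<inter> B\<close>.\<close>
  define X where "X B n i = T -` (if i = Suc n then A \<inter> B else - A) \<inter> space N" for B n i
  define C where "C B n = {v \<in> space ?\<Pi>. \<forall>i\<in>{1..Suc n}. v i \<in> X B n i}" for B n
  have L_compl: "- A \<in> sets L"
    using sets.compl_sets[OF A] by (simp add: L Compl_eq_Diff_UNIV)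
  have rej: "N.prob (T -` (- A) \<inter> space N) = 1 - p"
  proof -
    have "T -` (- A) \<inter> space N = space N - (T -` A \<inter> space N)" by auto
    then show ?thesis unfolding p_def by (simp add: N.prob_compl)
  qed
  have X: "X B n i \<in> sets N" if "B \<in> sets L" for B n i
    unfolding X_def using that A L_compl by (intro measurable_sets[OF T]) auto
  \<comment> \<open>A cylinder over finitely many coordinates: independence gives its probability as
    a finite product.\<close>
  have C_emb: "C B n = prod_emb {1..} (\<lambda>_. N) {1..Suc n} (\<Pi>\<^sub>E i\<in>{1..Suc n}. X B n i)" for B n
    by (auto simp: C_def prod_emb_def space_PiM Pi_iff)
  have C_sets: "C B n \<in> sets ?\<Pi>" if "B \<in> sets L" for B n
    unfolding C_emb using X[OF that] by (intro sets_PiM_I) auto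
  have C_measure: "measure ?\<Pi> (C B n) = (1 - p) ^ n * q B" if "B \<in> sets L" for B n
  proof -
    have "measure ?\<Pi> (C B n) = (\<Prod>i\<in>{1..Suc n}. N.prob (X B n i))"
      unfolding C_emb using X[OF that] by (intro measure_PiM_emb) auto
    also have "\<dots> = (\<Prod>i\<in>{1..n}. 1 - p) * q B"
      by (simp add: X_def q_def rej)
    finally show ?thesis by simp
  qed
  have hit: "T (v (Suc n)) \<in> A \<inter> B" if "v \<in> C B n" for v B n
  proof -
    have "v (Suc n) \<in> X B n (Suc n)" using that unfolding C_def by force
    then show ?thesis by (simp add: X_def)
  qed
  have miss: "T (v i) \<notin> A" if "v \<in> C B n" "1 \<le> i" "i < Suc n" for v B n i
  proof -
    have "v i \<in> X B n i" using that unfolding C_def by force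
    then show ?thesis using that by (simp add: X_def)
  qed
  have f_eq: "f v = T (v (Suc n)) \<and> f v \<in> A \<inter> B" if "v \<in> C B n" for v B n
  proof -
    have "(LEAST i. 1 \<le> i \<and> T (v i) \<in> A) = Suc n"
      using hit[OF that] miss[OF that] by (intro Least_equality) (auto simp: not_less[symmetric])
    then show ?thesis using hit[OF that] by (simp add: f_def)
  qed
  have C_disj: "disjoint_family (C B)" for B
  proof -
    \<comment> \<open>Attempt \<open>Suc m\<close> is a hit on \<open>C B m\<close> but one of the
      earlier misses on \<open>C B n\<close>.\<close>
    have "C B m \<inter> C B n = {}" if "m < n" for m n
      using that hit[of _ B m] miss[of _ B n "Suc m"] by fastforce
    then show ?thesis
      unfolding disjoint_family_on_def by (metis Int_commute linorder_neqE_nat)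
  qed
  show "distr ?\<Pi> L f = uniform_measure (distr N L T) A"
    if pos: "emeasure (distr N L T) A > 0"
  proof (rule measure_eqI)
    have em: "emeasure (distr N L T) A = ennreal p"
      by (simp add: emeasure_distr p_def N.emeasure_eq_measure)
    with pos have p_pos: "p > 0" by simp
    have p_le: "p \<le> 1" by (simp add: p_def)
    have UN: "measure ?\<Pi> (\<Union>n. C B n) = q B / p" if B: "B \<in> sets L" for B
    proof -
      have "(\<lambda>n. measure ?\<Pi> (C B n)) sums measure ?\<Pi> (\<Union>n. C B n)"
        by (intro finite_measure_UNION C_disj) (use C_sets[OF B] in blast)
      \<comment> \<open>The ratio \<open>1 - p\<close> lies in [0, 1) because 0 < p \<le> 1; this is
        where positive acceptance probability makes the series converge.\<close>
      moreover have "(\<lambda>n. (1 - p) ^ n * q B) sums (1 / (1 - (1 - p)) * q B)"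
        using p_pos p_le by (intro sums_mult2 geometric_sums) auto
      ultimately show ?thesis
        unfolding C_measure[OF B] by (simp add: sums_iff)
    qed
    \<comment> \<open>For \<open>B = UNIV\<close> the target is all of \<open>A\<close>, so
      \<open>q UNIV = p\<close> and the first-hit events have total probability 1.\<close>
    have AE_hit: "AE v in ?\<Pi>. \<exists>n. v \<in> C UNIV n"
    proof -
      have U: "UNIV \<in> sets L" using sets.top[of L] by (simp add: L)
      have "measure ?\<Pi> (\<Union>n. C UNIV n) = 1"
        using p_pos unfolding UN[OF U] by (simp add: q_def p_def)
      then have "AE v in ?\<Pi>. v \<in> (\<Union>n. C UNIV n)"
        using C_sets[OF U] by (subst (asm) prob_eq_1) auto
      then show ?thesis by simp
    qed
    fix B assume "B \<in> sets (distr ?\<Pi> L f)"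
    then have B[measurable]: "B \<in> sets L" by simp
    have "measure ?\<Pi> (f -` B \<inter> space ?\<Pi>) = measure ?\<Pi> (\<Union>n. C B n)"
    proof (rule finite_measure_eq_AE)
      \<comment> \<open>The two sets agree only almost everywhere: with no accepted attempt,
        \<open>f v\<close> is a default value that may happen to lie in \<open>B\<close>.\<close>
      show "AE v in ?\<Pi>. v \<in> f -` B \<inter> space ?\<Pi> \<longleftrightarrow> v \<in> (\<Union>n. C B n)"
        using AE_hit
      proof eventually_elim
        case (elim v)
        then obtain n where n: "v \<in> C UNIV n" by blast
        have "v \<in> C B n" if "f v \<in> B"
          using n f_eq[OF n] that by (auto simp: C_def X_def)
        moreover have "v \<in> space ?\<Pi>" using n by (simp add: C_def)
        ultimately show ?case using f_eq[of v B] by auto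
      qed
    next
      show "f -` B \<inter> space ?\<Pi> \<in> sets ?\<Pi>" by (rule measurable_sets[OF f B])
      show "(\<Union>n. C B n) \<in> sets ?\<Pi>" using C_sets[OF B] by blast
    qed
    then have "emeasure (distr ?\<Pi> L f) B = ennreal (q B / p)"
      by (simp only: emeasure_distr[OF f B] P.emeasure_eq_measure UN[OF B])
    also have "\<dots> = ennreal (q B) / ennreal p"
      using p_pos by (simp add: divide_ennreal q_def)
    also have "\<dots> = emeasure (uniform_measure (distr N L T) A) B"
      by (simp add: em) (simp add: emeasure_distr q_def N.emeasure_eq_measure)
    finally show "emeasure (distr ?\<Pi> L f) B = emeasure (uniform_measure (distr N L T) A) B" .
  qed simp
qed

text \<open>Intersecting with \<open>P\<close> changes no subset of \<open>A\<close>, and the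
  normalising factor \<open>emeasure M P\<close> cancels because it is neither 0 nor
  infinite.\<close>

lemma uniform_measure_uniform_measure:
  assumes "A \<in> sets M" "P \<in> sets M" "A \<subseteq> P" "emeasure M P \<noteq> 0" "emeasure M P \<noteq> \<infinity>"
  shows "uniform_measure (uniform_measure M P) A = uniform_measure M A"
proof (rule measure_eqI)
  fix B assume "B \<in> sets (uniform_measure (uniform_measure M P) A)"
  then have B: "B \<in> sets M" by simp
  have sub: "P \<inter> A = A" "P \<inter> (A \<inter> B) = A \<inter> B" using assms(3) by auto
  obtain r where r: "emeasure M P = ennreal r" "r > 0"
    using assms(4,5) by (cases "emeasure M P") (auto simp: less_le)
  have fin: "emeasure M C \<noteq> \<infinity>" if "C \<subseteq> A" for C
    using emeasure_mono[of C P M] subset_trans[OF that assms(3)] assms(2,5)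
    by (auto simp: top_unique)
  obtain a b where ab: "emeasure M A = ennreal a" "a \<ge> 0"
    "emeasure M (A \<inter> B) = ennreal b" "b \<ge> 0"
    using fin[of A] fin[of "A \<inter> B"]
    by (cases "emeasure M A"; cases "emeasure M (A \<inter> B)") auto
  \<comment> \<open>If \<open>A\<close> is null, both quotients have the form 0 / 0, which is 0 in
    \<open>ennreal\<close>.\<close>
  have "b = 0" if "a = 0"
    using emeasure_mono[of "A \<inter> B" A M] assms(1) ab that by auto
  then have "ennreal b / ennreal r / (ennreal a / ennreal r) = ennreal b / ennreal a"
    using r ab(2,4) by (cases "a = 0") (auto simp: divide_ennreal)
  then show "emeasure (uniform_measure (uniform_measure M P) A) B
      = emeasure (uniform_measure M A) B"
    using assms B by (simp add: sub r(1) ab)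
qed simp

section \<open>Folding into a basic cell\<close>

lemma lattice_point_minus: "lattice_point G (- j) = - lattice_point G j"
  by (simp add: lattice_point_def matrix_vector_mult_def vec_eq_iff sum_negf)

text \<open>Covering gives existence and disjointness gives uniqueness, of the integer index itself
  and not only of the lattice point. The tiling is used below only in this form.\<close>

lemma basic_cell_ex1:
  assumes "basic_cell G P"
  shows "\<exists>!j. w - lattice_point G j \<in> P"
proof -
  have mem: "w \<in> (\<lambda>p. p + lattice_point G j) ` P \<longleftrightarrow> w - lattice_point G j \<in> P" for j
    by (auto simp: image_iff intro!: bexI[of _ "w - lattice_point G j"])
  have "w \<in> (\<Union>j. (\<lambda>p. p + lattice_point G j) ` P)"
    using assms by (simp add: basic_cell_def)
  then obtain j where "w - lattice_point G j \<in> P"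
    using mem by blast
  moreover have "i = j" if "w - lattice_point G i \<in> P" "w - lattice_point G j \<in> P" for i j
  proof (rule ccontr)
    assume "i \<noteq> j"
    then have "(\<lambda>p. p + lattice_point G i) ` P \<inter> (\<lambda>p. p + lattice_point G j) ` P = {}"
      using assms by (simp add: basic_cell_def disjoint_family_on_def)
    with that mem[of i] mem[of j] show False by blast
  qed
  ultimately show ?thesis by blast
qed

text \<open>Reduction modulo the lattice to the representative in the fundamental domain
  \<open>P\<close>.\<close>

definition fold_cell :: "real^'n^'n \<Rightarrow> (real^'n) set \<Rightarrow> real^'n \<Rightarrow> real^'n" where
  "fold_cell G P w = w - lattice_point G (THE j. w - lattice_point G j \<in> P)"

lemma fold_cell_eq:
  assumes "basic_cell G P" "w - lattice_point G j \<in> P"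
  shows "fold_cell G P w = w - lattice_point G j"
  unfolding fold_cell_def
  using the1_equality[OF basic_cell_ex1[OF assms(1)] assms(2)] by simp

text \<open>Because the quantizer uses the reflected cell, \<open>- w\<close> lies in
  \<open>- P + y\<close> exactly when \<open>w + y\<close> lies in \<open>P\<close>; hence
  \<open>y\<close> is minus the lattice part of \<open>w\<close>. It is applied with
  \<open>w\<close> the dither minus the input.\<close>

lemma cell_quantizer_eq:
  assumes "basic_cell G P"
  shows "cell_quantizer G P (- w) = fold_cell G P w - w"
proof -
  obtain j where j: "w - lattice_point G j \<in> P"
    using basic_cell_ex1[OF assms] by blast
  have mem: "- w \<in> (\<lambda>p. - p + y) ` P \<longleftrightarrow> w + y \<in> P" for y
  proof -
    have "- w = - p + y \<longleftrightarrow> p = w + y" for p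
      by (auto simp: algebra_simps eq_neg_iff_add_eq_0)
    then show ?thesis by (auto simp: image_iff)
  qed
  have "cell_quantizer G P (- w) = - lattice_point G j"
    unfolding cell_quantizer_def
  proof (rule the_equality)
    show "- lattice_point G j \<in> lattice_points G \<and> - w \<in> (\<lambda>p. - p + - lattice_point G j) ` P"
      unfolding mem using j
      by (auto simp: lattice_points_def image_iff intro!: exI[of _ "- j"] simp: lattice_point_minus)
  next
    fix y assume y: "y \<in> lattice_points G \<and> - w \<in> (\<lambda>p. - p + y) ` P"
    then obtain i where i: "y = lattice_point G i" by (auto simp: lattice_points_def)
    have "w - lattice_point G (- i) \<in> P"
      using y unfolding mem by (simp add: i lattice_point_minus)
    with j have "- i = j" using basic_cell_ex1[OF assms] by blast
    then show "y = - lattice_point G j" by (auto simp: i lattice_point_minus)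
  qed
  then show ?thesis by (simp add: fold_cell_eq[OF assms j])
qed

text \<open>Folding acts as a single translation on each of the countably many translates of
  \<open>P\<close>.\<close>

lemma vimage_fold_cell:
  assumes "basic_cell G P"
  shows "fold_cell G P -` E = (\<Union>j. {w. w - lattice_point G j \<in> E \<inter> P})"
proof (intro set_eqI)
  fix w
  obtain j where "w - lattice_point G j \<in> P"
    using basic_cell_ex1[OF assms] by blast
  then show "w \<in> fold_cell G P -` E \<longleftrightarrow> w \<in> (\<Union>j. {w. w - lattice_point G j \<in> E \<inter> P})"
    using fold_cell_eq[OF assms, of w] basic_cell_ex1[OF assms, of w] by auto
qed

section \<open>Lebesgue measure under translation and folding\<close>

lemma
  fixes E :: "'a::euclidean_space set"
  assumes "E \<in> sets lebesgue"
  shows sets_lebesgue_shift: "{w. w - a \<in> E} \<in> sets lebesgue"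
    and emeasure_lebesgue_shift: "emeasure lebesgue {w. w - a \<in> E} = emeasure lebesgue E"
proof -
  have "{w. w - a \<in> E} = (\<lambda>w. a + w) ` E" by (auto simp: image_iff intro!: bexI[of _ "_ - a"])
  then show "{w. w - a \<in> E} \<in> sets lebesgue"
    "emeasure lebesgue {w. w - a \<in> E} = emeasure lebesgue E"
    using lebesgue_sets_translation[OF assms, of a] emeasure_lebesgue_affine[of 1 a E]
    by (simp_all add: add.commute)
qed

text \<open>The part of \<open>P\<close> that folds into \<open>E\<close> is cut according to the
  lattice vector subtracted. Each piece is translated, keeping its measure, and the translated
  pieces tile \<open>P \<inter> E\<close>.\<close>

lemma
  assumes cell: "basic_cell G P" and P: "P \<in> sets lebesgue"
  shows measurable_fold_cell: "(\<lambda>v. fold_cell G P (v - x)) \<in> measurable lebesgue lebesgue"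
    and emeasure_fold_cell: "E \<in> sets lebesgue \<Longrightarrow>
      emeasure lebesgue (P \<inter> (\<lambda>v. fold_cell G P (v - x)) -` E) = emeasure lebesgue (P \<inter> E)"
proof -
  let ?T = "\<lambda>v. fold_cell G P (v - x)"
  define D where "D E j = {v. v - (x + lattice_point G j) \<in> E \<inter> P}" for E j
  have vim: "?T -` E = (\<Union>j. D E j)" for E
    using vimage_fold_cell[OF cell, of E] by (auto simp: D_def set_eq_iff diff_diff_eq)
  have D: "D E j \<in> sets lebesgue" if "E \<in> sets lebesgue" for E j
    unfolding D_def using that P by (intro sets_lebesgue_shift) auto
  then have "?T -` E \<in> sets lebesgue" if "E \<in> sets lebesgue" for E
    unfolding vim using that by (intro sets.countable_UN') auto
  then show "?T \<in> measurable lebesgue lebesgue"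
    by (intro measurableI) auto
  show "emeasure lebesgue (P \<inter> ?T -` E) = emeasure lebesgue (P \<inter> E)"
    if E: "E \<in> sets lebesgue"
  proof -
    \<comment> \<open>\<open>F j\<close> is the piece \<open>P \<inter> D E j\<close> after
      translation by \<open>- (x + lattice_point G j)\<close>.\<close>
    define F where "F j = {w \<in> E \<inter> P. w + x + lattice_point G j \<in> P}" for j
    have shift: "P \<inter> D E j = {v. v - (x + lattice_point G j) \<in> F j}" for j
      by (auto simp: D_def F_def algebra_simps)
    \<comment> \<open>Undoing that translation exhibits \<open>F j\<close> as a shift of a
      measurable set.\<close>
    have F_eq: "F j = {w. w - (- (x + lattice_point G j)) \<in> P \<inter> D E j}" for j
      by (auto simp: D_def F_def algebra_simps)
    have F: "F j \<in> sets lebesgue" for j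
      unfolding F_eq using P D[OF E] by (intro sets_lebesgue_shift) auto
    \<comment> \<open>For \<open>w\<close> in \<open>P \<inter> E\<close>, the index
      \<open>- j\<close> must be the unique one bringing \<open>w + x\<close> into \<open>P\<close>;
      hence the sets \<open>F j\<close> partition \<open>P \<inter> E\<close>.\<close>
    have F_mem: "w \<in> F j \<longleftrightarrow> w \<in> P \<inter> E \<and> (w + x) - lattice_point G (- j) \<in> P" for w j
      by (auto simp: F_def lattice_point_minus algebra_simps)
    have F_UN: "(\<Union>j. F j) = P \<inter> E"
    proof -
      have "\<exists>j. (w + x) - lattice_point G (- j) \<in> P" for w
        using basic_cell_ex1[OF cell, of "w + x"] by (metis minus_minus)
      then show ?thesis using F_mem by blast
    qed
    have F_disj: "disjoint_family F"
    proof -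
      have "i = j" if "w \<in> F i" "w \<in> F j" for w i j
        using that basic_cell_ex1[OF cell, of "w + x"] unfolding F_mem
        by (metis neg_equal_iff_equal)
      then show ?thesis unfolding disjoint_family_on_def by blast
    qed
    have D_disj: "disjoint_family (\<lambda>j. P \<inter> D E j)"
    proof -
      have "(v - x) - lattice_point G j \<in> P" if "v \<in> D E j" for v j
        using that by (simp add: D_def diff_diff_eq)
      then have "i = j" if "v \<in> D E i" "v \<in> D E j" for v i j
        using that basic_cell_ex1[OF cell, of "v - x"] by blast
      then show ?thesis unfolding disjoint_family_on_def by blast
    qed
    have "emeasure lebesgue (P \<inter> ?T -` E) = emeasure lebesgue (\<Union>j. P \<inter> D E j)"
      unfolding vim by (simp only: Int_UN_distrib)
    also have "\<dots> = (\<integral>\<^sup>+j. emeasure lebesgue (P \<inter> D E j) \<partial>count_space UNIV)"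
      using P D[OF E] D_disj by (intro emeasure_UN_countable) auto
    also have "\<dots> = (\<integral>\<^sup>+j. emeasure lebesgue (F j) \<partial>count_space UNIV)"
      unfolding shift by (simp only: emeasure_lebesgue_shift[OF F])
    also have "\<dots> = emeasure lebesgue (\<Union>j. F j)"
      using F F_disj by (intro emeasure_UN_countable[symmetric]) auto
    finally show ?thesis unfolding F_UN .
  qed
qed

lemma distr_fold_cell:
  assumes "basic_cell G P" "P \<in> sets lebesgue" "emeasure lebesgue P > 0"
  shows "distr (uniform_measure lebesgue P) lebesgue (\<lambda>v. fold_cell G P (v - x))
    = uniform_measure lebesgue P"
proof (rule measure_eqI)
  let ?T = "\<lambda>v. fold_cell G P (v - x)"
  have T: "?T \<in> measurable lebesgue lebesgue"
    using assms by (intro measurable_fold_cell)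
  then have T': "?T \<in> measurable (uniform_measure lebesgue P) lebesgue"
    by simp
  fix E assume "E \<in> sets (distr (uniform_measure lebesgue P) lebesgue ?T)"
  then have E: "E \<in> sets lebesgue" by simp
  have "?T -` E \<in> sets lebesgue"
    using measurable_sets[OF T E] by simp
  then show "emeasure (distr (uniform_measure lebesgue P) lebesgue ?T) E
      = emeasure (uniform_measure lebesgue P) E"
    using assms E emeasure_fold_cell[OF assms(1,2) E, of x]
    by (simp add: emeasure_distr[OF T'] del: emeasure_completion)
qed simp

text \<open>Both the acceptance test and the output error see an attempt only through its folded
  dither, so the quantizer takes the form treated in
  \<open>distr_rejection_sampling\<close>.\<close>

lemma rsuq_error_eq:
  fixes x :: "real^'n"
  assumes "basic_cell G P"
  defines "T \<equiv> \<lambda>v. fold_cell G P (v - x)"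
  shows "rsuq G A P x v - x = T (v (LEAST i. 1 \<le> i \<and> T (v i) \<in> A))"
proof -
  have "cell_quantizer G P (x - u) + u - x = T u" for u
    using cell_quantizer_eq[OF assms(1), of "u - x"] by (simp add: T_def)
  then show ?thesis by (simp add: rsuq_def Let_def)
qed

section \<open>The law of the quantization error\<close>

theorem proposition5:
  fixes G :: "real^'n^'n" and P A :: "(real^'n) set" and x :: "real^'n"
    and M :: "'w measure" and S :: "'w \<Rightarrow> nat \<Rightarrow> real^'n"
  assumes "rank G = CARD('n)"
    and "P \<in> sets lebesgue" and "basic_cell G P"
    and "A \<in> sets lebesgue" and "A \<subseteq> P" and "emeasure lebesgue A > 0"
    and "prob_space M"
    and "S \<in> measurable M (rsuq_state P)" and "distr M (rsuq_state P) S = rsuq_state P"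
  shows "(\<lambda>\<omega>. rsuq G A P x (S \<omega>) - x) \<in> measurable M lebesgue \<and>
    distr M lebesgue (\<lambda>\<omega>. rsuq G A P x (S \<omega>) - x) = uniform_measure lebesgue A"
proof -
  define U where "U = uniform_measure lebesgue P"
  define T where "T v = fold_cell G P (v - x)" for v
  define f where "f v = T (v (LEAST i::nat. 1 \<le> i \<and> T (v i) \<in> A))" for v
  have P_pos: "emeasure lebesgue P > 0"
    using assms(2,5,6) emeasure_mono[of A P lebesgue] by (auto intro: less_le_trans)
  \<comment> \<open>Boundedness of the cell gives it finite measure, so that \<open>U\<close> is a
    probability measure.\<close>
  have P_fin: "emeasure lebesgue P \<noteq> \<infinity>"
    using fmeasurableD2[OF bounded_set_imp_lmeasurable[OF _ assms(2)]] assms(3)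
    by (simp add: basic_cell_def del: emeasure_completion)
  have U: "prob_space U"
    unfolding U_def using P_pos P_fin by (intro prob_space_uniform_measure) auto
  have T: "T \<in> measurable U lebesgue"
    unfolding U_def T_def using measurable_fold_cell[OF assms(3,2)] by simp
  have distr_T: "distr U lebesgue T = U"
    unfolding U_def T_def using distr_fold_cell[OF assms(3,2) P_pos] .
  have error: "rsuq G A P x v - x = f v" for v
    unfolding f_def T_def by (rule rsuq_error_eq[OF assms(3)])
  have state: "rsuq_state P = (\<Pi>\<^sub>M i\<in>{1..}. U)"
    by (simp add: rsuq_state_def U_def)
  \<comment> \<open>The acceptance probability of one attempt is the ratio of the measures of
    \<open>A\<close> and \<open>P\<close>.\<close>
  have U_A: "emeasure U A > 0"
    using assms(2,4,5,6) P_fin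
    by (simp add: U_def Int_absorb1 ennreal_zero_less_divide top.not_eq_extremum
        del: emeasure_completion)
  have f: "f \<in> measurable (rsuq_state P) lebesgue"
    unfolding state f_def by (rule measurable_rejection_sampling[OF U T _ assms(4)]) simp
  \<comment> \<open>The error depends on the outcome only through the state, so its law is the image
    of \<open>rsuq_state P\<close> under \<open>f\<close>.\<close>
  have "distr M lebesgue (\<lambda>\<omega>. f (S \<omega>)) = distr (distr M (rsuq_state P) S) lebesgue f"
    using distr_distr[OF f assms(8)] by (simp add: comp_def)
  also have "\<dots> = distr (\<Pi>\<^sub>M i\<in>{1..}. U) lebesgue f"
    unfolding assms(9) by (simp only: state)
  also have "\<dots> = uniform_measure (distr U lebesgue T) A"
    unfolding f_def
    by (rule distr_rejection_sampling[OF U T _ assms(4)]) (simp_all add: distr_T U_A)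
  also have "\<dots> = uniform_measure lebesgue A"
    unfolding distr_T unfolding U_def using assms(2,4,5) P_pos P_fin
    by (intro uniform_measure_uniform_measure) auto
  finally show ?thesis
    using measurable_compose[OF assms(8) f] by (simp add: error)
qed

end
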